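(* Let $R$ be an associative ring with unity, $a\in R$ and $n\in\mathbb{N}$. The following are equivalent: (1) $a$ is $pns$-Drazin invertible. (2) There exists $p\in R$ with $p^2=p\in\mathrm{comm}^2(a)$ such that $ap\in\sqrt{J(R)}$ and $1-(a+p)^n\in\sqrt{J(R)}$.
   Context: $\mathbb{N}$ is the set of positive integers. For a ring $R$, $J(R)$ is the Jacobson radical and $\sqrt{J(R)}=\{x\in R: x^k\in J(R)\text{ for some }k\ge 1\}$. For $x\in R$: $\mathrm{comm}(x)=\{y\in R: xy=yx\}$ and $\mathrm{comm}^2(x)=\{y\in R: yz=zy\text{ for all }z\in\mathrm{comm}(x)\}$. For fixed $n\in\mathbb{N}$, $a\in R$ is $pns$-Drazin invertible (pseudo $n$-strong Drazin invertible) if there exists $x\in R$ with $xax=x$, $x\in\mathrm{comm}^2(a)$ and $a^n-ax\in\sqrt{J(R)}$. *)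

theory Defs
  imports Main
begin

text \<open>
  An associative ring with unity is a type of sort \<open>{ring, monoid_mult}\<close>. Unlike
  \<open>ring_1\<close>, this sort does not require \<open>0 \<noteq> 1\<close>, so the zero ring is included.
  Multiplication is not assumed to be commutative.
\<close>

text \<open>Closure under negation is the case \<open>r = -1\<close> of the last conjunct.\<close>

definition left_ideal :: "'a::{ring,monoid_mult} set \<Rightarrow> bool" where
  "left_ideal I \<longleftrightarrow>
     0 \<in> I \<and> (\<forall>x\<in>I. \<forall>y\<in>I. x + y \<in> I) \<and> (\<forall>r. \<forall>x\<in>I. r * x \<in> I)"

definition maximal_left_ideal :: "'a::{ring,monoid_mult} set \<Rightarrow> bool" where
  "maximal_left_ideal M \<longleftrightarrow>
     left_ideal M \<and> M \<noteq> UNIV \<and> (\<forall>I. left_ideal I \<and> M \<subseteq> I \<longrightarrow> I = M \<or> I = UNIV)"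

text \<open>In the zero ring the intersection is over the empty family, hence the whole ring.\<close>

definition jacobson_radical :: "'a::{ring,monoid_mult} set" where
  "jacobson_radical = \<Inter> {M. maximal_left_ideal M}"

definition sqrt_jacobson :: "'a::{ring,monoid_mult} set" where
  "sqrt_jacobson = {x. \<exists>k::nat. k \<ge> 1 \<and> x ^ k \<in> jacobson_radical}"

definition comm :: "'a::{ring,monoid_mult} \<Rightarrow> 'a set" where
  "comm x = {y. x * y = y * x}"

definition comm2 :: "'a::{ring,monoid_mult} \<Rightarrow> 'a set" where
  "comm2 x = {y. \<forall>z\<in>comm x. y * z = z * y}"

definition pns_drazin_invertible :: "nat \<Rightarrow> 'a::{ring,monoid_mult} \<Rightarrow> bool" where
  "pns_drazin_invertible n a \<longleftrightarrow>
     (\<exists>x. x * a * x = x \<and> x \<in> comm2 a \<and> a ^ n - a * x \<in> sqrt_jacobson)"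

end

theory Submission
  imports Defs
begin

text \<open>
  Only two properties of \<open>J = J(R)\<close> are needed: it is a left ideal, and \<open>1 - y\<close> is a unit for
  \<open>y \<in> J\<close>. All elements involved commute, and among commuting elements the set \<open>\<surd>J\<close> is closed
  under addition and absorbs multiplication; moreover \<open>1 - q\<close> is a unit for \<open>q \<in> \<surd>J\<close>.
  Given \<open>x\<close>, take \<open>p = 1 - a x\<close>. Given \<open>p\<close>, the element \<open>u = a + p\<close> is a unit because \<open>u\<^sup>n\<close> is, and
  \<open>x = u\<^sup>-\<^sup>1 (1 - p)\<close>. Both verifications split along \<open>1 = p + (1 - p)\<close>, using
  \<open>u\<^sup>n (1 - p) = a\<^sup>n (1 - p)\<close> and \<open>u\<^sup>n p = (1 + a)\<^sup>n p\<close>.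
\<close>

section \<open>Left ideals and the Jacobson radical\<close>

lemma left_ideal_add: "left_ideal I \<Longrightarrow> x \<in> I \<Longrightarrow> y \<in> I \<Longrightarrow> x + y \<in> I"
  by (simp add: left_ideal_def)

lemma left_ideal_mult: "left_ideal I \<Longrightarrow> x \<in> I \<Longrightarrow> r * x \<in> I"
  by (simp add: left_ideal_def)

lemma left_ideal_eq_UNIV_iff: "left_ideal I \<Longrightarrow> I = UNIV \<longleftrightarrow> 1 \<in> I"
  using left_ideal_mult[of I 1] by auto

lemma left_ideal_principal: "left_ideal (range (\<lambda>r. r * (x::'a::{ring,monoid_mult})))"
  unfolding left_ideal_def
proof (intro conjI ballI allI)
  show "0 \<in> range (\<lambda>r. r * x)" by (rule range_eqI[of _ _ 0]) simp
next
  fix y z assume "y \<in> range (\<lambda>r. r * x)" "z \<in> range (\<lambda>r. r * x)"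
  then show "y + z \<in> range (\<lambda>r. r * x)" by (auto simp flip: distrib_right)
next
  fix r y assume "y \<in> range (\<lambda>r. r * x)"
  then show "r * y \<in> range (\<lambda>r. r * x)" by (auto simp flip: mult.assoc)
qed

text \<open>Comparability within the chain is what makes sums work: the larger of the two members
  involved contains both summands.\<close>

lemma left_ideal_Union_chain:
  assumes "C \<noteq> {}" "subset.chain {I. left_ideal I} C"
  shows "left_ideal (\<Union>C)"
  unfolding left_ideal_def
proof (intro conjI ballI allI)
  have ideal: "left_ideal I" if "I \<in> C" for I
    using that assms(2) by (auto simp: subset.chain_def)
  show "0 \<in> \<Union>C" using assms(1) ideal by (auto simp: left_ideal_def)
  fix x assume "x \<in> \<Union>C"
  then obtain I where I: "I \<in> C" "x \<in> I" by auto
  show "r * x \<in> \<Union>C" for r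
    using I left_ideal_mult[OF ideal] by auto
  fix y assume "y \<in> \<Union>C"
  then obtain K where K: "K \<in> C" "y \<in> K" by auto
  have "I \<subseteq> K \<or> K \<subseteq> I"
    using assms(2) I K by (auto simp: subset.chain_def)
  then show "x + y \<in> \<Union>C"
    using I K left_ideal_add[OF ideal] by blast
qed

text \<open>Zorn's lemma applies to the left ideals that contain \<open>I\<close> and omit
  \<open>1\<close>. For a left ideal, omitting \<open>1\<close> means being proper, and this form
  visibly passes to unions of chains.\<close>

lemma maximal_left_ideal_exists:
  fixes I :: "'a::{ring,monoid_mult} set"
  assumes I: "left_ideal I" "1 \<notin> I"
  obtains M where "maximal_left_ideal M" "I \<subseteq> M"
proof -
  let ?A = "{K. left_ideal K \<and> I \<subseteq> K \<and> 1 \<notin> K}"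
  have "\<exists>M\<in>?A. \<forall>X\<in>?A. M \<subseteq> X \<longrightarrow> X = M"
  proof (rule subset_Zorn_nonempty)
    show "?A \<noteq> {}" using I by auto
    fix C assume C: "C \<noteq> {}" "subset.chain ?A C"
    then have "subset.chain {K. left_ideal K} C"
      by (auto simp: subset.chain_def)
    then have "left_ideal (\<Union>C)" using C(1) by (rule left_ideal_Union_chain[rotated])
    then show "\<Union>C \<in> ?A" using C by (fastforce simp: subset.chain_def)
  qed
  then obtain M where M: "M \<in> ?A" and "\<forall>X\<in>?A. M \<subseteq> X \<longrightarrow> X = M" ..
  then have max: "X = M" if "left_ideal X" "I \<subseteq> X" "1 \<notin> X" "M \<subseteq> X" for X
    using that by simp
  have "maximal_left_ideal M"
    unfolding maximal_left_ideal_def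
  proof (intro conjI allI impI)
    show "left_ideal M" "M \<noteq> UNIV" using M by auto
    fix K assume K: "left_ideal K \<and> M \<subseteq> K"
    then show "K = M \<or> K = UNIV"
      using max[of K] M left_ideal_eq_UNIV_iff[of K] by auto
  qed
  then show thesis using that M by blast
qed

lemma left_ideal_jacobson_radical: "left_ideal jacobson_radical"
  by (auto simp: jacobson_radical_def maximal_left_ideal_def left_ideal_def)

text \<open>If the left ideal generated by \<open>1 - y\<close> omitted \<open>1\<close>, a maximal
  left ideal above it would contain both \<open>1 - y\<close> and \<open>y\<close>, hence
  \<open>1\<close>.\<close>

lemma jacobson_radical_left_inverse:
  fixes y :: "'a::{ring,monoid_mult}"
  assumes y: "y \<in> jacobson_radical"
  obtains z where "z * (1 - y) = 1"
proof (cases "1 \<in> range (\<lambda>r. r * (1 - y))")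
  case True
  then obtain z where "1 = z * (1 - y)" by auto
  then show thesis by (intro that) simp
next
  case False
  obtain M where M: "maximal_left_ideal M" "range (\<lambda>r. r * (1 - y)) \<subseteq> M"
    using maximal_left_ideal_exists[OF left_ideal_principal False] .
  have "1 * (1 - y) \<in> M" using M(2) by blast
  moreover have "y \<in> M" using y M(1) by (auto simp: jacobson_radical_def)
  moreover have ideal: "left_ideal M" using M(1) by (simp add: maximal_left_ideal_def)
  ultimately have "1 * (1 - y) + y \<in> M" by (intro left_ideal_add)
  then have "M = UNIV" using ideal by (simp add: left_ideal_eq_UNIV_iff)
  then show thesis using M(1) by (simp add: maximal_left_ideal_def)
qed

lemma left_right_inverse_eq:
  fixes x :: "'a::monoid_mult"
  assumes "l * x = 1" "x * r = 1"
  shows "l = r"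
  by (metis assms mult.assoc mult_1_left mult_1_right)

lemma jacobson_radical_inverse:
  fixes y :: "'a::{ring,monoid_mult}"
  assumes y: "y \<in> jacobson_radical"
  obtains z where "z * (1 - y) = 1" "(1 - y) * z = 1"
proof -
  obtain z where z: "z * (1 - y) = 1" using jacobson_radical_left_inverse[OF y] .
  \<comment> \<open>The left inverse \<open>z\<close> again has the form one minus a radical
    element, so it has a left inverse \<open>w\<close> itself. With inverses on both sides,
    \<open>z\<close> is a unit and \<open>w = 1 - y\<close>.\<close>
  then have z_eq: "z = 1 - (- z) * y" by (simp add: algebra_simps)
  have "(- z) * y \<in> jacobson_radical"
    using left_ideal_mult[OF left_ideal_jacobson_radical y] .
  then obtain w where "w * z = 1"
    using jacobson_radical_left_inverse z_eq by metis
  then have "w = 1 - y" using z by (rule left_right_inverse_eq)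
  then show thesis using that z \<open>w * z = 1\<close> by simp
qed

section \<open>Powers of commuting elements\<close>

lemma mult_commutes:
  fixes x y z :: "'a::semigroup_mult"
  assumes "x * z = z * x" "y * z = z * y"
  shows "x * y * z = z * (x * y)"
  by (metis assms mult.assoc)

lemma power_mult_commuting:
  fixes x y :: "'a::monoid_mult"
  assumes "x * y = y * x"
  shows "(x * y) ^ k = x ^ k * y ^ k"
proof (induction k)
  case (Suc k)
  have "(x * y) ^ Suc k = x * (y * x ^ k) * y ^ k"
    using Suc by (simp add: mult.assoc)
  also have "y * x ^ k = x ^ k * y"
    using power_commuting_commutes[OF assms] by simp
  finally show ?case by (simp add: mult.assoc)
qed simp

text \<open>Serves to compute powers of \<open>a + p\<close> on each of the two complementary
  idempotents \<open>c = 1 - p\<close> and \<open>c = p\<close>.\<close>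

lemma power_mult_right_cong:
  fixes u v c :: "'a::monoid_mult"
  assumes "u * c = v * c" "v * c = c * v"
  shows "u ^ k * c = v ^ k * c"
proof (induction k)
  case (Suc k)
  have "u ^ Suc k * c = (u ^ k * c) * v"
    using assms by (simp add: power_Suc2 mult.assoc del: power_Suc)
  also have "\<dots> = v ^ Suc k * c"
    using Suc assms by (simp add: power_Suc2 mult.assoc del: power_Suc)
  finally show ?case .
qed simp

lemma idempotent_power:
  fixes p :: "'a::monoid_mult"
  assumes "p * p = p" "k \<ge> 1"
  shows "p ^ k = p"
  using assms(2) by (induction k rule: dec_induct) (use assms(1) in auto)

text \<open>The cofactor \<open>s\<close> is the geometric sum
  \<open>1 + q + ... + q ^ (k - 1)\<close>; as a polynomial in \<open>q\<close> it commutes with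
  everything that \<open>q\<close> commutes with.\<close>

lemma one_minus_power_factor:
  fixes q :: "'a::{ring,monoid_mult}"
  obtains s where "1 - q ^ k = (1 - q) * s" "\<And>z. q * z = z * q \<Longrightarrow> s * z = z * s"
proof -
  have "\<exists>s. 1 - q ^ k = (1 - q) * s \<and> (\<forall>z. q * z = z * q \<longrightarrow> s * z = z * s)"
  proof (induction k)
    case 0
    show ?case by (intro exI[of _ 0]) simp
  next
    case (Suc k)
    then obtain s where s: "1 - q ^ k = (1 - q) * s" "\<And>z. q * z = z * q \<Longrightarrow> s * z = z * s"
      by blast
    have "1 - q ^ Suc k = (1 - q ^ k) + (1 - q) * q ^ k"
      by (simp add: algebra_simps)
    also have "\<dots> = (1 - q) * (s + q ^ k)"
      using s(1) by (simp add: algebra_simps)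
    finally show ?case
      using s(2) power_commuting_commutes
      by (intro exI[of _ "s + q ^ k"]) (auto simp: distrib_left distrib_right)
  qed
  then show thesis using that by blast
qed

text \<open>The extra factor \<open>t\<close> replaces the binomial expansion: it absorbs one factor of
  \<open>x + y\<close> per induction step.\<close>

lemma left_ideal_power_add:
  fixes x y t :: "'a::{ring,monoid_mult}"
  assumes I: "left_ideal I" and xy: "x * y = y * x"
    and "x ^ k * t \<in> I" "y ^ m * t \<in> I"
  shows "(x + y) ^ (k + m) * t \<in> I"
  using assms(3,4)
proof (induction "k + m" arbitrary: k m t)
  case 0
  then show ?case by simp
next
  case (Suc s)
  show ?case
  proof (cases "k = 0 \<or> m = 0")
    case True
    \<comment> \<open>A zero exponent puts \<open>t\<close> itself in \<open>I\<close>.\<close>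
    then show ?thesis using Suc.prems left_ideal_mult[OF I] by auto
  next
    case False
    then obtain k' m' where km: "k = Suc k'" "m = Suc m'"
      by (meson not0_implies_Suc)
    have "(x + y) ^ (k' + m) * (x * t) \<in> I"
    proof (rule Suc.hyps(1))
      have "x ^ k' * (x * t) = x ^ k * t"
        by (simp add: km power_Suc2 mult.assoc del: power_Suc)
      then show "x ^ k' * (x * t) \<in> I" using Suc.prems by simp
      have "y ^ m * (x * t) = x * (y ^ m * t)"
        using power_commuting_commutes[OF xy[symmetric], of m] by (simp flip: mult.assoc)
      then show "y ^ m * (x * t) \<in> I"
        using Suc.prems left_ideal_mult[OF I] by simp
    qed (use Suc.hyps(2) km in simp)
    moreover have "(x + y) ^ (k + m') * (y * t) \<in> I"
    proof (rule Suc.hyps(1))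
      have "x ^ k * (y * t) = y * (x ^ k * t)"
        using power_commuting_commutes[OF xy, of k] by (simp flip: mult.assoc)
      then show "x ^ k * (y * t) \<in> I"
        using Suc.prems left_ideal_mult[OF I] by simp
      have "y ^ m' * (y * t) = y ^ m * t"
        by (simp add: km power_Suc2 mult.assoc del: power_Suc)
      then show "y ^ m' * (y * t) \<in> I" using Suc.prems by simp
    qed (use Suc.hyps(2) km in simp)
    ultimately have "(x + y) ^ (k' + m) * (x * t) + (x + y) ^ (k + m') * (y * t) \<in> I"
      by (rule left_ideal_add[OF I])
    moreover have "(x + y) ^ (k' + m) * (x * t) + (x + y) ^ (k + m') * (y * t)
      = (x + y) ^ (k + m) * t"
      by (simp add: km power_Suc2 distrib_left distrib_right mult.assoc del: power_Suc)
    ultimately show ?thesis by simp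
  qed
qed

section \<open>The square root of the Jacobson radical\<close>

lemma sqrt_jacobson_add:
  fixes x y :: "'a::{ring,monoid_mult}"
  assumes "x \<in> sqrt_jacobson" "y \<in> sqrt_jacobson" "x * y = y * x"
  shows "x + y \<in> sqrt_jacobson"
proof -
  obtain k m where "k \<ge> 1" "x ^ k \<in> jacobson_radical" "y ^ m \<in> jacobson_radical"
    using assms by (auto simp: sqrt_jacobson_def)
  then have "(x + y) ^ (k + m) \<in> jacobson_radical" "k + m \<ge> 1"
    using left_ideal_power_add[OF left_ideal_jacobson_radical assms(3), of k 1 m] by auto
  then show ?thesis unfolding sqrt_jacobson_def by blast
qed

lemma sqrt_jacobson_mult:
  fixes x y :: "'a::{ring,monoid_mult}"
  assumes "x \<in> sqrt_jacobson" "x * y = y * x"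
  shows "x * y \<in> sqrt_jacobson"
proof -
  obtain k where k: "k \<ge> 1" "x ^ k \<in> jacobson_radical"
    using assms by (auto simp: sqrt_jacobson_def)
  \<comment> \<open>The radical is available as a left ideal, so the factor lying in it must stand
    on the right.\<close>
  have "(x * y) ^ k = y ^ k * x ^ k"
    using assms(2) power_mult_commuting[of y x k] by simp
  then show ?thesis
    using k left_ideal_mult[OF left_ideal_jacobson_radical k(2), of "y ^ k"]
    unfolding sqrt_jacobson_def by auto
qed

lemma sqrt_jacobson_of_power:
  fixes x :: "'a::{ring,monoid_mult}"
  assumes "n \<ge> 1" "x ^ n \<in> sqrt_jacobson"
  shows "x \<in> sqrt_jacobson"
proof -
  obtain k where "k \<ge> 1" "x ^ (n * k) \<in> jacobson_radical"
    using assms(2) by (auto simp: sqrt_jacobson_def simp flip: power_mult)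
  moreover have "n * k \<ge> 1" using assms(1) \<open>k \<ge> 1\<close> by simp
  ultimately show ?thesis unfolding sqrt_jacobson_def by blast
qed

text \<open>Some \<open>1 - q ^ k\<close> is a unit, and \<open>1 - q\<close> divides it with a
  commuting cofactor; this gives an inverse of \<open>1 - q\<close> on each side.\<close>

lemma sqrt_jacobson_inverse:
  fixes q :: "'a::{ring,monoid_mult}"
  assumes "q \<in> sqrt_jacobson"
  obtains v where "v * (1 - q) = 1" "(1 - q) * v = 1"
proof -
  obtain k where "q ^ k \<in> jacobson_radical"
    using assms by (auto simp: sqrt_jacobson_def)
  then obtain w where w: "w * (1 - q ^ k) = 1" "(1 - q ^ k) * w = 1"
    using jacobson_radical_inverse by blast
  obtain s where s: "1 - q ^ k = (1 - q) * s" "\<And>z. q * z = z * q \<Longrightarrow> s * z = z * s"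
    using one_minus_power_factor[of q k] by blast
  have "s * (1 - q) = (1 - q) * s"
    using s(2)[of "1 - q"] by (simp add: algebra_simps)
  then have l: "(w * s) * (1 - q) = 1"
    using w(1) s(1) by (simp add: mult.assoc)
  have r: "(1 - q) * (s * w) = 1"
    using w(2) s(1) by (simp add: mult.assoc)
  show thesis using that[of "s * w"] l r left_right_inverse_eq[OF l r] by simp
qed

lemma inverse_commutes:
  fixes u :: "'a::monoid_mult"
  assumes "v * u = 1" "u * v = 1" "u * z = z * u"
  shows "v * z = z * v"
proof -
  have "v * z = v * (z * u) * v" using assms(2) by (simp add: mult.assoc)
  also have "\<dots> = (v * u) * (z * v)" by (simp add: mult.assoc flip: assms(3))
  finally show ?thesis using assms(1) by simp
qed

section \<open>Pseudo strong Drazin inverses and spectral idempotents\<close>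

lemma pns_drazin_spectral_idempotent:
  fixes a x :: "'a::{ring,monoid_mult}"
  assumes n: "n \<ge> 1" and xax: "x * a * x = x" and x: "x \<in> comm2 a"
    and w: "a ^ n - a * x \<in> sqrt_jacobson"
  defines "p \<equiv> 1 - a * x"
  shows "p ^ 2 = p" "p \<in> comm2 a" "a * p \<in> sqrt_jacobson" "1 - (a + p) ^ n \<in> sqrt_jacobson"
proof -
  define e where "e = a * x"
  have p_e: "p = 1 - e" by (simp add: p_def e_def)
  have e_comm: "e * z = z * e" if "a * z = z * a" for z
    using x that by (auto simp: comm2_def comm_def e_def) (metis mult.assoc)
  have ee: "e * e = e" using xax by (simp add: e_def mult.assoc)
  have pp: "p * p = p" by (simp add: p_e algebra_simps ee)
  then show "p ^ 2 = p" by (simp add: power2_eq_square)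
  have p_comm: "p * z = z * p" if "a * z = z * a" for z
    using e_comm[OF that] by (simp add: p_e algebra_simps)
  then show "p \<in> comm2 a" by (auto simp: comm2_def comm_def)
  have ep: "e * p = 0" by (simp add: p_e algebra_simps ee)
  have ap: "a * p = p * a" using p_comm[of a] by simp
  have ae: "a * e = e * a" using e_comm[of a] by simp
  define w where "w = a ^ n - e"
  have w_sqrt: "w \<in> sqrt_jacobson" using assms(4) by (simp add: w_def e_def)
  have aw: "a * w = w * a" using ae by (simp add: w_def algebra_simps power_commutes)
  have "w * p \<in> sqrt_jacobson"
    using w_sqrt p_comm[OF aw, symmetric] by (rule sqrt_jacobson_mult)
  \<comment> \<open>Here \<open>e * p = 0\<close> removes the second term of \<open>w\<close>, and
    \<open>p = p ^ n\<close> since \<open>n \<ge> 1\<close>.\<close>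
  moreover have "w * p = (a * p) ^ n"
    by (simp add: w_def left_diff_distrib ep power_mult_commuting[OF ap] idempotent_power[OF pp n])
  ultimately show ap_sqrt: "a * p \<in> sqrt_jacobson"
    using sqrt_jacobson_of_power[OF n] by simp
  define u where "u = a + p"
  \<comment> \<open>Since \<open>1 - (1 + a) = - a\<close>, this factorization makes
    \<open>(1 - (1 + a) ^ n) * p\<close> a multiple of \<open>a * p\<close>.\<close>
  obtain s where s: "1 - (1 + a) ^ n = (1 - (1 + a)) * s"
      "\<And>z. (1 + a) * z = z * (1 + a) \<Longrightarrow> s * z = z * s"
    using one_minus_power_factor[of "1 + a" n] by blast
  have s_comm: "s * z = z * s" if "a * z = z * a" for z
    using s(2)[of z] that by (simp add: algebra_simps)
  have "u ^ n * e = a ^ n * e"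
    using ae ep e_comm[of p] ap by (intro power_mult_right_cong) (simp_all add: u_def distrib_right)
  moreover have "u ^ n * p = (1 + a) ^ n * p"
    using pp ap by (intro power_mult_right_cong) (simp_all add: u_def algebra_simps)
  moreover have "1 - u ^ n = (1 - u ^ n) * e + (1 - u ^ n) * p"
    by (simp add: p_e algebra_simps)
  ultimately have "1 - u ^ n = (1 - a ^ n) * e + (1 - (1 + a) ^ n) * p"
    by (simp add: left_diff_distrib)
  also have "(1 - a ^ n) * e = w * (- e)"
    by (simp add: w_def algebra_simps ee)
  also have "(1 - (1 + a) ^ n) * p = (a * p) * (- s)"
    by (simp add: s(1) mult.assoc s_comm[OF ap])
  finally have split: "1 - u ^ n = w * (- e) + (a * p) * (- s)" .
  have "w * (- e) \<in> sqrt_jacobson"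
    using w_sqrt e_comm[OF aw] by (intro sqrt_jacobson_mult) simp_all
  moreover have "(a * p) * (- s) \<in> sqrt_jacobson"
  proof (rule sqrt_jacobson_mult[OF ap_sqrt])
    have "s * (a * p) = (a * p) * s"
      by (intro s_comm) (simp add: mult.assoc flip: ap)
    then show "a * p * - s = - s * (a * p)" by simp
  qed
  \<comment> \<open>Addition in \<open>sqrt_jacobson\<close> requires commuting summands. The second
    summand commutes with \<open>a\<close>, hence with \<open>e\<close>, and therefore with
    \<open>w = a ^ n - e\<close>.\<close>
  moreover have "(w * (- e)) * ((a * p) * (- s)) = ((a * p) * (- s)) * (w * (- e))"
  proof (rule mult_commutes)
    have "(a * p) * (- s) * a = a * ((a * p) * (- s))"
    proof (intro mult_commutes)
      show "p * a = a * p" by (simp add: ap)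
      show "- s * a = a * - s" using s_comm[of a] by simp
    qed simp
    then have *: "a * ((a * p) * (- s)) = (a * p) * (- s) * a" by simp
    show "- e * ((a * p) * (- s)) = (a * p) * (- s) * - e"
      using e_comm[OF *] by simp
    have "a ^ n * ((a * p) * (- s)) = (a * p) * (- s) * a ^ n"
      by (rule power_commuting_commutes) (rule *)
    then show "w * ((a * p) * (- s)) = (a * p) * (- s) * w"
      using e_comm[OF *] unfolding w_def left_diff_distrib right_diff_distrib by simp
  qed
  ultimately show "1 - (a + p) ^ n \<in> sqrt_jacobson"
    unfolding split[unfolded u_def] by (rule sqrt_jacobson_add)
qed

text \<open>With \<open>e = 1 - p\<close> and \<open>u = a + p\<close>, one has
  \<open>u * e = a * e\<close> because \<open>p * e = 0\<close>. Hence the inverse of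
  \<open>u\<close>, cut down to \<open>e\<close>, inverts \<open>a\<close> there.\<close>

lemma pns_drazin_invertible_of_idempotent:
  fixes a p :: "'a::{ring,monoid_mult}"
  assumes n: "n \<ge> 1" and p2: "p ^ 2 = p" and p: "p \<in> comm2 a"
    and ap_sqrt: "a * p \<in> sqrt_jacobson" and q_sqrt: "1 - (a + p) ^ n \<in> sqrt_jacobson"
  shows "pns_drazin_invertible n a"
proof -
  define u e where "u = a + p" and "e = 1 - p"
  have pp: "p * p = p" using p2 by (simp add: power2_eq_square)
  have p_comm: "p * z = z * p" if "a * z = z * a" for z
    using p that by (auto simp: comm2_def comm_def)
  have e_comm: "e * z = z * e" if "a * z = z * a" for z
    using p_comm[OF that] by (simp add: e_def algebra_simps)
  have u_comm: "u * z = z * u" if "a * z = z * a" for z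
    using p_comm[OF that] that by (simp add: u_def algebra_simps)
  have ap: "a * p = p * a" using p_comm[of a] by simp
  have ae: "a * e = e * a" using e_comm[of a] by simp
  have ee: "e * e = e" by (simp add: e_def algebra_simps pp)
  have pe: "p * e = 0" by (simp add: e_def algebra_simps pp)
  have ue: "u * e = a * e" using pe by (simp add: u_def distrib_right)
  have au: "a * u = u * a" using u_comm[of a] by simp
  \<comment> \<open>The power \<open>u ^ n\<close> is one minus the element \<open>1 - u ^ n\<close>
    of \<open>sqrt_jacobson\<close>. Splitting off one factor \<open>u\<close> on either side then
    yields a left and a right inverse of \<open>u\<close>.\<close>
  obtain v where v: "v * u ^ n = 1" "u ^ n * v = 1"
    using sqrt_jacobson_inverse[OF q_sqrt] by (auto simp: u_def)
  obtain m where m: "n = Suc m" using n by (cases n) auto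
  have l: "(v * u ^ m) * u = 1" using v(1) by (simp add: m power_Suc2 mult.assoc del: power_Suc)
  have r: "u * (u ^ m * v) = 1" using v(2) by (simp add: m mult.assoc)
  define i where "i = v * u ^ m"
  have i: "i * u = 1" "u * i = 1"
    using l r left_right_inverse_eq[OF l r] by (simp_all add: i_def)
  have i_comm: "i * z = z * i" if "a * z = z * a" for z
    using inverse_commutes[OF i u_comm[OF that]] .
  define x where "x = i * e"
  have ax: "a * x = e"
  proof -
    have "a * x = i * (u * e)" using i_comm[of a] by (simp add: x_def ue flip: mult.assoc)
    also have "\<dots> = e" using i(1) by (simp flip: mult.assoc)
    finally show ?thesis .
  qed
  have x_comm: "x * z = z * x" if "a * z = z * a" for z
    using i_comm[OF that] e_comm[OF that] unfolding x_def by (metis mult.assoc)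
  have "x * a * x = x" by (simp add: mult.assoc ax) (simp add: x_def mult.assoc ee)
  moreover have "x \<in> comm2 a" using x_comm by (auto simp: comm2_def comm_def)
  moreover have "a ^ n - a * x \<in> sqrt_jacobson"
  proof -
    define q where "q = 1 - u ^ n"
    have "u ^ n * a = a * u ^ n" by (rule power_commuting_commutes) (simp add: au)
    then have aq: "a * q = q * a" by (simp add: q_def algebra_simps)
    have "u ^ n * e = a ^ n * e"
      using ae ue by (intro power_mult_right_cong) simp_all
    moreover have "a ^ n = a ^ n * e + a ^ n * p" by (simp add: e_def algebra_simps)
    moreover have "a ^ n * p = (a * p) * a ^ m"
      using p_comm[of "a ^ m"] by (simp add: m power_commutes mult.assoc)
    \<comment> \<open>On \<open>e\<close> the difference is
      \<open>(a ^ n - 1) * e = - (1 - u ^ n) * e\<close>; on \<open>p\<close> it is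
      \<open>a ^ n * p\<close>, where \<open>n \<ge> 1\<close> supplies the factor
      \<open>a * p\<close>.\<close>
    ultimately have split: "a ^ n - a * x = q * (- e) + (a * p) * a ^ m"
      by (simp add: ax q_def algebra_simps)
    have "q * (- e) \<in> sqrt_jacobson"
      using q_sqrt e_comm[OF aq] by (intro sqrt_jacobson_mult) (simp_all add: q_def u_def)
    moreover have "(a * p) * a ^ m \<in> sqrt_jacobson"
    proof (rule sqrt_jacobson_mult[OF ap_sqrt])
      have "a ^ m * p = p * a ^ m" using p_comm[of "a ^ m"] by (simp add: power_commutes)
      then show "a * p * a ^ m = a ^ m * (a * p)"
        by (intro mult_commutes) (simp_all add: power_commutes)
    qed
    moreover have "(q * (- e)) * ((a * p) * a ^ m) = ((a * p) * a ^ m) * (q * (- e))"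
    proof (rule mult_commutes)
      \<comment> \<open>As in the converse direction, commuting with \<open>a\<close> suffices: it
        implies commuting with \<open>e\<close> and with \<open>u\<close>, hence with
        \<open>q = 1 - u ^ n\<close>.\<close>
      have "(a * p) * a ^ m * a = a * ((a * p) * a ^ m)"
        using ap by (intro mult_commutes) (simp_all add: power_commutes)
      then have *: "a * ((a * p) * a ^ m) = (a * p) * a ^ m * a" by simp
      show "- e * ((a * p) * a ^ m) = (a * p) * a ^ m * - e"
        using e_comm[OF *] by simp
      have "u ^ n * ((a * p) * a ^ m) = (a * p) * a ^ m * u ^ n"
        by (rule power_commuting_commutes) (rule u_comm[OF *])
      then show "q * ((a * p) * a ^ m) = (a * p) * a ^ m * q"
        unfolding q_def left_diff_distrib right_diff_distrib by simp
    qed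
    ultimately show ?thesis unfolding split by (rule sqrt_jacobson_add)
  qed
  ultimately show ?thesis unfolding pns_drazin_invertible_def by blast
qed

theorem corollary2p9:
  fixes a :: "'a::{ring,monoid_mult}" and n :: nat
  assumes "n \<ge> 1"
  shows "pns_drazin_invertible n a \<longleftrightarrow>
    (\<exists>p. p ^ 2 = p \<and> p \<in> comm2 a \<and> a * p \<in> sqrt_jacobson \<and> 1 - (a + p) ^ n \<in> sqrt_jacobson)"
proof
  assume "pns_drazin_invertible n a"
  then obtain x where "x * a * x = x" "x \<in> comm2 a" "a ^ n - a * x \<in> sqrt_jacobson"
    unfolding pns_drazin_invertible_def by blast
  from pns_drazin_spectral_idempotent[OF assms this]
  show "\<exists>p. p ^ 2 = p \<and> p \<in> comm2 a \<and> a * p \<in> sqrt_jacobson \<and> 1 - (a + p) ^ n \<in> sqrt_jacobson"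
    by (intro exI conjI)
next
  assume "\<exists>p. p ^ 2 = p \<and> p \<in> comm2 a \<and> a * p \<in> sqrt_jacobson \<and> 1 - (a + p) ^ n \<in> sqrt_jacobson"
  then show "pns_drazin_invertible n a"
    using pns_drazin_invertible_of_idempotent[OF assms] by (elim exE conjE)
qed

end
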